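(* Let $p>0$. Let $f(z)=\sum_{n=0}^\infty a_nz^n$ be analytic in the unit disk $\mathbb{D}$ with $\sup_{z\in\mathbb{D}}|f(z)|\le1$, and put $a=|a_0|$, where $a<1$. Let $r_{a,p}$ be the minimum positive root in $(0,1)$ of the equation $A_{a,p}(r)=0$, where $$A_{a,p}(r)=[1-(2-a^2)r](1+ar)^p-(1-r)(r+a)^p.$$ Then $$|f(z)|^p+\sum_{n=1}^\infty|a_n|r^n+\left(\frac1{1+a}+\frac r{1-r}\right)\sum_{n=1}^\infty|a_n|^2r^{2n}\le1\qquad( * )$$ for $|z|=r\le r_{a,p}$. The radius $r_{a,p}$ is best possible: for every $a\in[0,1)$ and every $\rho\in(r_{a,p},1)$ there exist such an $f$ with $|f(0)|=a$ and a point $z$ with $|z|=r\le\rho$ for which $( * )$ fails.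
   Context: $\mathbb{D}=\{z\in\mathbb{C}:|z|<1\}$. *)

theory Defs
  imports "HOL-Analysis.Analysis"
begin

definition bounded_by_one_expansion :: "(complex \<Rightarrow> complex) \<Rightarrow> (nat \<Rightarrow> complex) \<Rightarrow> bool" where
  "bounded_by_one_expansion f c \<longleftrightarrow>
     f analytic_on ball 0 1 \<and>
     (\<forall>z\<in>ball 0 1. (\<lambda>n. c n * z ^ n) sums f z) \<and>
     (\<forall>z\<in>ball 0 1. norm (f z) \<le> 1)"

definition A_fun :: "real \<Rightarrow> real \<Rightarrow> real \<Rightarrow> real" where
  "A_fun a p r = (1 - (2 - a\<^sup>2) * r) * (1 + a * r) powr p - (1 - r) * (r + a) powr p"

(* LEAST on the reals is meaningful only when the minimum is attained; see r_min_is_least. *)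
definition r_min :: "real \<Rightarrow> real \<Rightarrow> real" where
  "r_min a p = (LEAST r. 0 < r \<and> r < 1 \<and> A_fun a p r = 0)"

(* Both series start at index 1; they converge for norm z < 1, see bohr_series_summable. *)
definition bohr_lhs :: "real \<Rightarrow> (complex \<Rightarrow> complex) \<Rightarrow> (nat \<Rightarrow> complex) \<Rightarrow> complex \<Rightarrow> real" where
  "bohr_lhs p f c z =
     (let a = norm (c 0); r = norm z in
        norm (f z) powr p
        + (\<Sum>n. norm (c (Suc n)) * r ^ Suc n)
        + (1 / (1 + a) + r / (1 - r)) * (\<Sum>n. (norm (c (Suc n)))\<^sup>2 * r ^ (2 * Suc n)))"

lemma r_min_is_least:
  assumes p: "0 < p" and a: "0 \<le> a" "a < 1"
  shows "0 < r_min a p" "r_min a p < 1" "A_fun a p (r_min a p) = 0"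
    and "\<And>r. 0 < r \<Longrightarrow> r < 1 \<Longrightarrow> A_fun a p r = 0 \<Longrightarrow> r_min a p \<le> r"
proof -
  define S where "S = {r\<in>{0..1}. A_fun a p r = 0}"
  have cont: "continuous_on {0..1} (A_fun a p)"
    unfolding A_fun_def using p a
    by (intro continuous_intros continuous_on_powr') (auto simp: add_nonneg_eq_0_iff)
  have A0: "A_fun a p 0 > 0"
  proof -
    have "a powr p < 1 powr p"
      using p a by (intro powr_less_mono2) auto
    then show ?thesis by (simp add: A_fun_def)
  qed
  have "a * a < 1 * 1"
    using a by (intro mult_strict_mono') auto
  then have A1: "A_fun a p 1 < 0"
    using a by (auto simp: A_fun_def power2_eq_square intro!: mult_neg_pos)
  have "\<exists>r\<ge>0. r \<le> 1 \<and> A_fun a p r = 0"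
    using cont A0 A1 by (intro IVT2') auto
  then have "S \<noteq> {}" by (auto simp: S_def)
  moreover have "compact S"
  proof -
    have "closed S"
      unfolding S_def by (rule continuous_closed_preimage_constant[OF cont]) simp
    moreover have "bounded S"
      unfolding S_def by (rule bounded_subset[OF bounded_closed_interval[of 0 1]]) auto
    ultimately show ?thesis by (simp add: compact_eq_bounded_closed)
  qed
  ultimately obtain m where m: "m \<in> S" "\<And>t. t \<in> S \<Longrightarrow> m \<le> t"
    using compact_attains_inf by meson
  have "m \<noteq> 0" "m \<noteq> 1" using m(1) A0 A1 by (auto simp: S_def)
  then have mm: "0 < m" "m < 1" "A_fun a p m = 0" using m(1) by (auto simp: S_def)
  have le: "m \<le> r" if "0 < r" "r < 1" "A_fun a p r = 0" for r
    using m(2) that by (auto simp: S_def)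
  have "r_min a p = m"
    unfolding r_min_def by (rule Least_equality) (use mm le in auto)
  with mm le show "0 < r_min a p" "r_min a p < 1" "A_fun a p (r_min a p) = 0"
    "\<And>r. 0 < r \<Longrightarrow> r < 1 \<Longrightarrow> A_fun a p r = 0 \<Longrightarrow> r_min a p \<le> r"
    by auto
qed

lemma bohr_series_summable:
  fixes z :: complex
  assumes f: "bounded_by_one_expansion f c" and z: "norm z < 1"
  shows "summable (\<lambda>n. norm (c (Suc n)) * norm z ^ Suc n)"
    and "summable (\<lambda>n. (norm (c (Suc n)))\<^sup>2 * norm z ^ (2 * Suc n))"
proof -
  define w where "w = complex_of_real ((1 + norm z) / 2)"
  have w: "norm z < norm w" "norm w < 1"
  proof -
    have "norm w = (1 + norm z) / 2"
      unfolding w_def norm_of_real by simp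
    then show "norm z < norm w" "norm w < 1" using z by simp_all
  qed
  have "summable (\<lambda>n. c n * w ^ n)"
    using f w(2) by (auto simp: bounded_by_one_expansion_def dist_norm sums_iff)
  then have *: "summable (\<lambda>n. norm (c n) * norm z ^ n)"
    using powser_insidea[OF _ w(1)] by (simp add: norm_mult norm_power)
  then show 1: "summable (\<lambda>n. norm (c (Suc n)) * norm z ^ Suc n)"
    by (subst summable_Suc_iff)
  have "summable (\<lambda>n. (norm (c (Suc n)) * norm z ^ Suc n)\<^sup>2)"
  proof (rule summable_comparison_test_ev[OF _ 1])
    have "\<forall>\<^sub>F n in sequentially. norm (c (Suc n)) * norm z ^ Suc n < 1"
      using order_tendstoD(2)[OF summable_LIMSEQ_zero[OF 1], of 1] by simp
    then show "\<forall>\<^sub>F n in sequentially.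
        norm ((norm (c (Suc n)) * norm z ^ Suc n)\<^sup>2) \<le> norm (c (Suc n)) * norm z ^ Suc n"
    proof eventually_elim
      case (elim n)
      then show ?case
        using mult_left_le[of "norm (c (Suc n)) * norm z ^ Suc n" "norm (c (Suc n)) * norm z ^ Suc n"]
        unfolding power2_eq_square real_norm_def abs_mult by simp
    qed
  qed
  then show "summable (\<lambda>n. (norm (c (Suc n)))\<^sup>2 * norm z ^ (2 * Suc n))"
    by (simp only: power_mult_distrib power_even_eq)
qed

end

theory Submission
  imports Defs "HOL-Complex_Analysis.Complex_Analysis"
begin

text \<open>
  Write \<open>a\<close> for the modulus of the constant coefficient.  Two independent sharp estimates give the
  inequality.  By Schwarz--Pick, \<open>|f z| \<le> (r + a) / (1 + a r)\<close>.  The two coefficient series together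
  are at most \<open>(1 - a\<^sup>2) r / (1 - r)\<close>, for every \<open>r < 1\<close> (\<open>bohr_sum_le\<close>).  So the
  left-hand side is at most \<open>1 - G r\<close>, where
  \<open>G r = 1 - (1 - a\<^sup>2) r / (1 - r) - ((r + a) / (1 + a r)) powr p\<close> is, up to the positive factor
  \<open>(1 - r) (1 + a r) powr p\<close>, the function whose zero defines the radius.  Since \<open>G\<close> is strictly
  decreasing, it is nonnegative exactly up to that zero.

  The disc automorphism \<open>(a - z) / (1 - a z)\<close> at \<open>z = - r\<close> makes both estimates equalities: its
  left-hand side is \<open>1 - G r\<close>, which exceeds 1 at every point beyond the zero of \<open>G\<close>.  Strict
  monotonicity matters here as well: a zero where \<open>G\<close> does not change sign would not be optimal.

  The series estimate comes from Carlson's inequalities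
  \<open>|c\<^bsub>2n+1\<^esub>| \<le> 1 - |c\<^sub>0|\<^sup>2 - \<dots> - |c\<^sub>n|\<^sup>2\<close> and
  \<open>|c\<^bsub>2n\<^esub>| \<le> 1 - |c\<^sub>0|\<^sup>2 - \<dots> - |c\<^bsub>n-1\<^esub>|\<^sup>2 - |c\<^sub>n|\<^sup>2 / (1 + a)\<close>.  Summed against powers
  of \<open>r\<close>, the subtracted squares produce exactly the weight \<open>1 / (1 + a) + r / (1 - r)\<close>.  Carlson's
  inequalities follow from a device of Landau: for a polynomial \<open>q\<close>, the coefficients of \<open>f q\<^sup>2\<close>
  are bounded by the mean of \<open>|q|\<^sup>2\<close> on the unit circle, which is the sum of the squared moduli of the
  coefficients of \<open>q\<close>; a good choice of \<open>q\<close> turns this into the inequality.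
\<close>

section \<open>Coefficients of a bounded function times the square of a polynomial\<close>

lemma has_integral_exp_period:
  "((\<lambda>t. exp (2 * of_real pi * \<i> * of_int n * of_real t)) has_integral (if n = 0 then 1 else 0)) {0..1::real}"
proof (cases "n = 0")
  case True
  then show ?thesis
    using has_integral_const_real[of "1::complex" 0 1] by simp
next
  case False
  define k where "k = 2 * of_real pi * \<i> * of_int n"
  have k: "k \<noteq> 0" using False by (simp add: k_def)
  have "((\<lambda>t. exp (k * of_real t)) has_integral (exp (k * of_real 1) / k - exp (k * of_real 0) / k)) {0..1::real}"
    by (rule fundamental_theorem_of_calculus)
       (auto intro!: derivative_eq_intros has_vector_derivative_real_field simp: k)
  moreover have "exp k = 1"
    unfolding k_def exp_eq_1 by (intro conjI exI[of _ n]) auto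
  ultimately show ?thesis using False by (simp add: k_def)
qed

text \<open>
  Parseval's identity for a polynomial: expanding \<open>|q|\<^sup>2 = q * cnj q\<close> into monomials, only the
  diagonal terms have a nonzero mean.
\<close>

lemma has_integral_norm_poly_circlepath:
  fixes q :: "complex poly"
  shows "((\<lambda>t. (norm (poly q (circlepath 0 \<rho> t)))\<^sup>2) has_integral
           (\<Sum>k\<le>degree q. (norm (coeff q k))\<^sup>2 * \<rho> ^ (2 * k))) {0..1}"
proof -
  let ?e = "\<lambda>(n::int) t::real. exp (2 * of_real pi * \<i> * of_int n * of_real t)"
  let ?q = "\<lambda>j. coeff q j * of_real \<rho> ^ j"
  have mono: "circlepath 0 \<rho> t ^ j * cnj (circlepath 0 \<rho> t ^ k)
      = of_real \<rho> ^ j * of_real \<rho> ^ k * ?e (int j - int k) t" for t j k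
  proof -
    have "circlepath 0 \<rho> t ^ j * cnj (circlepath 0 \<rho> t ^ k) = of_real \<rho> ^ j * of_real \<rho> ^ k *
        (exp (2 * of_real pi * \<i> * of_real t) ^ j * exp (- (2 * of_real pi * \<i> * of_real t)) ^ k)"
      by (simp add: circlepath power_mult_distrib exp_cnj)
    also have "exp (2 * of_real pi * \<i> * of_real t) ^ j * exp (- (2 * of_real pi * \<i> * of_real t)) ^ k
       = ?e (int j - int k) t"
      by (simp add: exp_of_nat_mult[symmetric] exp_add[symmetric] algebra_simps)
    finally show ?thesis .
  qed
  have expand: "of_real ((norm (poly q (circlepath 0 \<rho> t)))\<^sup>2)
      = (\<Sum>j\<le>degree q. \<Sum>k\<le>degree q. (?q j * cnj (?q k)) * ?e (int j - int k) t)" for t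
  proof -
    have "of_real ((norm (poly q (circlepath 0 \<rho> t)))\<^sup>2)
       = (\<Sum>j\<le>degree q. \<Sum>k\<le>degree q. coeff q j * cnj (coeff q k) *
            (circlepath 0 \<rho> t ^ j * cnj (circlepath 0 \<rho> t ^ k)))"
      unfolding complex_norm_square poly_altdef cnj_sum sum_product
      by (simp add: mult_ac)
    then show ?thesis by (simp only: mono) (simp add: mult_ac)
  qed
  have "((\<lambda>t. \<Sum>j\<le>degree q. \<Sum>k\<le>degree q. (?q j * cnj (?q k)) * ?e (int j - int k) t) has_integral
      (\<Sum>j\<le>degree q. \<Sum>k\<le>degree q. (?q j * cnj (?q k)) * (if int j - int k = 0 then 1 else 0))) {0..1}"
    by (intro has_integral_sum has_integral_mult_right has_integral_exp_period) auto
  also have "(\<Sum>j\<le>degree q. \<Sum>k\<le>degree q. (?q j * cnj (?q k)) * (if int j - int k = 0 then 1 else 0))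
      = (\<Sum>j\<le>degree q. \<Sum>k\<le>degree q. if k = j then ?q j * cnj (?q k) else 0)"
    by (intro sum.cong refl) auto
  also have "\<dots> = (\<Sum>j\<le>degree q. ?q j * cnj (?q j))"
    by (simp add: sum.delta')
  also have "\<dots> = of_real (\<Sum>j\<le>degree q. (norm (coeff q j))\<^sup>2 * \<rho> ^ (2 * j))"
    unfolding of_real_sum of_real_mult complex_norm_square
    by (intro sum.cong refl, subst mult_2) (simp add: power_add mult_ac)
  finally have "((\<lambda>t. complex_of_real ((norm (poly q (circlepath 0 \<rho> t)))\<^sup>2)) has_integral
      of_real (\<Sum>j\<le>degree q. (norm (coeff q j))\<^sup>2 * \<rho> ^ (2 * j))) {0..1}"
    by (simp only: expand)
  from has_integral_linear[OF this bounded_linear_Re] show ?thesis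
    by (simp add: o_def)
qed

text \<open>
  The left-hand side is the modulus of the \<open>m\<close>-th Taylor coefficient of \<open>f q\<^sup>2\<close>.  Cauchy's formula
  on the circle of radius \<open>\<rho>\<close>, with \<open>|f| \<le> 1\<close>, bounds it by \<open>\<rho> ^ (- m)\<close> times the mean of
  \<open>|q|\<^sup>2\<close>; then \<open>\<rho>\<close> tends to 1.
\<close>

lemma norm_coeff_times_poly_square_le:
  fixes q :: "complex poly"
  assumes f: "bounded_by_one_expansion f c"
  shows "norm (\<Sum>i\<le>m. c i * coeff (q * q) (m - i)) \<le> (\<Sum>k\<le>degree q. (norm (coeff q k))\<^sup>2)"
proof -
  define h where "h = (\<lambda>z. f z * poly (q * q) z)"
  define C where "C = (\<Sum>i\<le>m. c i * coeff (q * q) (m - i))"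
  define S where "S = (\<Sum>k\<le>degree q. (norm (coeff q k))\<^sup>2)"
  have holf: "f holomorphic_on ball 0 1"
    and sums: "\<And>z. z \<in> ball 0 1 \<Longrightarrow> (\<lambda>n. c n * z ^ n) sums f z"
    and le1: "\<And>z. z \<in> ball 0 1 \<Longrightarrow> norm (f z) \<le> 1"
    using f by (auto simp: bounded_by_one_expansion_def analytic_imp_holomorphic)
  have holh: "h holomorphic_on ball 0 1"
    unfolding h_def by (intro holomorphic_intros holf)
  have "f has_fps_expansion Abs_fps c"
    using eventually_nhds_in_open[of "ball 0 1" "0::complex"]
    by (intro has_fps_expansionI) (auto elim!: eventually_mono intro!: sums)
  moreover have "(poly (q * q)) has_fps_expansion fps_of_poly (q * q)"
    by (simp add: has_fps_expansion_def)
  ultimately have "h has_fps_expansion Abs_fps c * fps_of_poly (q * q)"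
    unfolding h_def by (rule has_fps_expansion_mult)
  from fps_nth_fps_expansion[OF this, of m]
  have C: "(deriv ^^ m) h 0 / fact m = C"
    by (simp add: C_def fps_mult_nth atLeast0AtMost)
  have bound: "norm C * \<rho> ^ m \<le> S" if \<rho>: "0 < \<rho>" "\<rho> < 1" for \<rho>
  proof -
    let ?\<gamma> = "circlepath 0 \<rho>"
    have norm_\<gamma>: "norm (?\<gamma> t) = \<rho>" for t
      using \<rho> by (simp add: circlepath norm_mult)
    have "((\<lambda>u. h u / (u - 0) ^ Suc m) has_contour_integral
        (2 * pi * \<i>) / fact m * (deriv ^^ m) h 0) ?\<gamma>"
      using \<rho>
      by (intro Cauchy_has_contour_integral_higher_derivative_circlepath
            holomorphic_on_imp_continuous_on holomorphic_on_subset[OF holh]) auto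
    then have "((\<lambda>t. h (?\<gamma> t) / ?\<gamma> t ^ Suc m * vector_derivative ?\<gamma> (at t)) has_integral
        2 * pi * \<i> * C) {0..1}"
      unfolding has_contour_integral C[symmetric] by simp
    moreover have "h (?\<gamma> t) / ?\<gamma> t ^ Suc m * vector_derivative ?\<gamma> (at t)
        = 2 * pi * \<i> * (h (?\<gamma> t) / ?\<gamma> t ^ m)" for t
      unfolding vector_derivative_circlepath
      using \<rho> by (simp add: circlepath field_simps)
    ultimately have I: "((\<lambda>t. 2 * pi * \<i> * (h (?\<gamma> t) / ?\<gamma> t ^ m)) has_integral 2 * pi * \<i> * C) {0..1}"
      by simp
    have J: "((\<lambda>t. 2 * pi / \<rho> ^ m * (norm (poly q (?\<gamma> t)))\<^sup>2) has_integral
        2 * pi / \<rho> ^ m * (\<Sum>k\<le>degree q. (norm (coeff q k))\<^sup>2 * \<rho> ^ (2 * k))) {0..1}"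
      by (intro has_integral_mult_right has_integral_norm_poly_circlepath)
    have "norm (2 * pi * \<i> * C) \<le> 2 * pi / \<rho> ^ m * (\<Sum>k\<le>degree q. (norm (coeff q k))\<^sup>2 * \<rho> ^ (2 * k))"
      unfolding integral_unique[OF I, symmetric] integral_unique[OF J, symmetric]
    proof (rule integral_norm_bound_integral)
      fix t :: real
      have "norm (f (?\<gamma> t)) * (norm (poly q (?\<gamma> t)))\<^sup>2 \<le> 1 * (norm (poly q (?\<gamma> t)))\<^sup>2"
        using \<rho> by (intro mult_right_mono le1) (auto simp: norm_\<gamma>)
      then show "norm (2 * pi * \<i> * (h (?\<gamma> t) / ?\<gamma> t ^ m)) \<le> 2 * pi / \<rho> ^ m * (norm (poly q (?\<gamma> t)))\<^sup>2"
        using \<rho> by (simp add: h_def norm_mult norm_divide norm_power norm_\<gamma> power2_eq_square field_simps)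
    qed (use I J in blast)+
    then have "norm C * \<rho> ^ m \<le> (\<Sum>k\<le>degree q. (norm (coeff q k))\<^sup>2 * \<rho> ^ (2 * k))"
      using \<rho> by (simp add: norm_mult field_simps)
    also have "\<dots> \<le> S"
      unfolding S_def using \<rho> by (intro sum_mono mult_left_le power_le_one) auto
    finally show ?thesis .
  qed
  have "norm C * 1 ^ m \<le> S"
  proof (rule tendsto_upperbound)
    show "((\<lambda>\<rho>. norm C * \<rho> ^ m) \<longlongrightarrow> norm C * 1 ^ m) (at_left (1::real))"
      by (intro tendsto_intros)
    show "\<forall>\<^sub>F \<rho> in at_left 1. norm C * \<rho> ^ m \<le> S"
      using eventually_at_left_real[of 0 "1::real"] by (rule eventually_mono) (auto intro: bound)
  qed auto
  then show ?thesis by (simp add: C_def S_def)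
qed


section \<open>Carlson's coefficient inequalities\<close>

text \<open>
  The previous bound for \<open>q = 1 + (\<Sum>i\<le>m div 2. v i * z ^ (m - i))\<close>.  All nonconstant terms of \<open>q\<close>
  have degree at least \<open>m / 2\<close>, so in the coefficient of \<open>z ^ m\<close> in \<open>f q\<^sup>2\<close> they contribute
  linearly, except for the square of the middle term when \<open>m\<close> is even.  The vector \<open>v\<close> remains
  free; choosing it well is what yields Carlson's inequalities.
\<close>

lemma weighted_coefficient_bound:
  fixes v :: "nat \<Rightarrow> complex"
  assumes f: "bounded_by_one_expansion f c" and "m > 0"
  shows "norm (c m + 2 * (\<Sum>i\<le>m div 2. c i * v i) + (if even m then c 0 * (v (m div 2))\<^sup>2 else 0))
    \<le> 1 + (\<Sum>i\<le>m div 2. (norm (v i))\<^sup>2)"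
proof -
  \<comment> \<open>The coefficients of \<open>q\<close>; on the support, the two requirements on \<open>j\<close> say \<open>m - j \<le> m div 2\<close>.\<close>
  define x where "x j = (if j = 0 then 1 else if j \<le> m \<and> m \<le> 2 * j then v (m - j) else 0)" for j
  define q where "q = (\<Sum>j\<le>m. monom (x j) j)"
  have coeff_q: "coeff q j = x j" for j
    by (simp add: q_def coeff_sum x_def)
  have deg: "degree q \<le> m"
    unfolding q_def by (intro degree_sum_le) (auto intro: order_trans[OF degree_monom_le])
  define n where "n = m div 2"
  have nm: "n < m" using \<open>m > 0\<close> by (simp add: n_def)
  have low: "coeff (q * q) l = (if l = 0 then 1 else 2 * x l)" if "l < m" for l
  proof (cases "l = 0")
    case False
    have "coeff (q * q) l = (\<Sum>j\<le>l. x j * x (l - j))"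
      by (simp add: coeff_mult coeff_q)
    also have "\<dots> = (\<Sum>j\<in>{0, l}. x j * x (l - j))"
      using that by (intro sum.mono_neutral_right) (auto simp: x_def)
    finally show ?thesis using False by (simp add: x_def)
  qed (simp add: coeff_mult coeff_q x_def)
  have top: "coeff (q * q) m = 2 * x m + (if even m then (v n)\<^sup>2 else 0)"
  proof -
    have "coeff (q * q) m = (\<Sum>j\<le>m. x j * x (m - j))"
      by (simp add: coeff_mult coeff_q)
    also have "\<dots> = (\<Sum>j\<in>{0, m} \<union> (if even m then {n} else {}). x j * x (m - j))"
    proof (intro sum.mono_neutral_right ballI)
      fix i assume i: "i \<in> {..m} - ({0, m} \<union> (if even m then {n} else {}))"
      then have "2 * i \<noteq> m" by (auto simp: n_def)
      then have "2 * i < m \<or> 2 * (m - i) < m" using i by auto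
      then show "x i * x (m - i) = 0" using i by (auto simp: x_def)
    qed (auto simp: n_def)
    finally show ?thesis using \<open>m > 0\<close>
      by (auto simp: x_def n_def power2_eq_square elim!: evenE split: if_splits)
  qed
  have x_rev: "x (m - i) = (if i \<le> n then v i else 0)" if "i < m" for i
    using that by (auto simp: x_def n_def)
  have "(\<Sum>i\<le>m. c i * coeff (q * q) (m - i))
      = c m + (\<Sum>i<m. c i * coeff (q * q) (m - i))"
    using low[of 0] \<open>m > 0\<close> by (simp add: lessThan_Suc_atMost[symmetric])
  also have "(\<Sum>i<m. c i * coeff (q * q) (m - i))
      = c 0 * coeff (q * q) m + (\<Sum>i\<in>{1..<m}. c i * coeff (q * q) (m - i))"
    using \<open>m > 0\<close> by (simp add: lessThan_atLeast0 sum.atLeast_Suc_lessThan)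
  also have "(\<Sum>i\<in>{1..<m}. c i * coeff (q * q) (m - i)) = (\<Sum>i\<in>{1..<m}. 2 * (c i * x (m - i)))"
    by (intro sum.cong refl) (simp add: low)
  also have "c 0 * coeff (q * q) m + (\<Sum>i\<in>{1..<m}. 2 * (c i * x (m - i)))
      = (if even m then c 0 * (v n)\<^sup>2 else 0) + (\<Sum>i<m. 2 * (c i * x (m - i)))"
    using \<open>m > 0\<close> by (simp add: top lessThan_atLeast0 sum.atLeast_Suc_lessThan algebra_simps)
  also have "(\<Sum>i<m. 2 * (c i * x (m - i))) = (\<Sum>i\<le>n. 2 * (c i * v i))"
    using nm by (intro sum.mono_neutral_cong_right) (auto simp: x_rev)
  finally have lhs: "(\<Sum>i\<le>m. c i * coeff (q * q) (m - i))
      = c m + 2 * (\<Sum>i\<le>n. c i * v i) + (if even m then c 0 * (v n)\<^sup>2 else 0)"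
    by (simp add: sum_distrib_left algebra_simps)
  have "(\<Sum>k\<le>degree q. (norm (coeff q k))\<^sup>2) = (\<Sum>k\<le>m. (norm (x k))\<^sup>2)"
    using deg by (intro sum.mono_neutral_cong_left) (auto simp: coeff_q coeff_eq_0 simp flip: coeff_q)
  also have "\<dots> = (\<Sum>i\<le>m. (norm (x (m - i)))\<^sup>2)"
    by (rule sum.reindex_bij_witness[of _ "\<lambda>i. m - i" "\<lambda>i. m - i"]) auto
  also have "\<dots> = 1 + (\<Sum>i<m. (norm (x (m - i)))\<^sup>2)"
    by (simp add: lessThan_Suc_atMost[symmetric] x_def)
  also have "(\<Sum>i<m. (norm (x (m - i)))\<^sup>2) = (\<Sum>i\<le>n. (norm (v i))\<^sup>2)"
    using nm by (intro sum.mono_neutral_cong_right) (auto simp: x_rev)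
  finally have rhs: "(\<Sum>k\<le>degree q. (norm (coeff q k))\<^sup>2) = 1 + (\<Sum>i\<le>n. (norm (v i))\<^sup>2)" .
  show ?thesis
    using norm_coeff_times_poly_square_le[OF f, where m = m and q = q] unfolding lhs rhs n_def .
qed

text \<open>Unlike \<^const>\<open>sgn\<close>, the phase \<open>e\<close> is unimodular even for \<open>w = 0\<close>.\<close>

lemma obtain_phase:
  obtains e :: complex where "norm e = 1" "cnj e * w = of_real (norm w)"
proof (cases "w = 0")
  case False
  have "cnj (sgn w) * w = of_real (norm w)"
    using False complex_norm_square[of w] by (simp add: sgn_eq power2_eq_square field_simps)
  then show ?thesis using False that[of "sgn w"] by (simp add: norm_sgn)
qed (use that[of 1] in simp)

text \<open>
  With \<open>v i = e * cnj (c i)\<close>, where \<open>e\<close> is the phase of \<open>c (2 * n + 1)\<close>, every term on the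
  left of the weighted bound has the same phase, so it reads \<open>|c (2 n + 1)| + 2 s \<le> 1 + s\<close>.
\<close>

lemma carlson_odd:
  assumes f: "bounded_by_one_expansion f c"
  shows "norm (c (2 * n + 1)) \<le> 1 - (\<Sum>k\<le>n. (norm (c k))\<^sup>2)"
proof -
  obtain e where e: "norm e = 1" "cnj e * c (2 * n + 1) = of_real (norm (c (2 * n + 1)))"
    by (rule obtain_phase)
  have e1: "cnj e * e = 1" using e(1) complex_norm_square[of e] by (simp add: mult.commute)
  define s where "s = (\<Sum>k\<le>n. (norm (c k))\<^sup>2)"
  have "norm (c (2 * n + 1) + 2 * (e * of_real s)) \<le> 1 + s"
    using weighted_coefficient_bound[OF f, of "2 * n + 1" "\<lambda>i. e * cnj (c i)"]
    by (simp add: s_def complex_norm_square sum_distrib_left norm_mult e(1) mult_ac del: of_real_power)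
  moreover have "norm (c (2 * n + 1)) + 2 * s \<le> norm (cnj e * (c (2 * n + 1) + 2 * (e * of_real s)))"
  proof -
    have "cnj e * (c (2 * n + 1) + 2 * (e * of_real s)) = of_real (norm (c (2 * n + 1)) + 2 * s)"
      using e(2) e1 by (simp add: algebra_simps)
    then show ?thesis by (simp only: norm_of_real)
  qed
  ultimately show ?thesis by (simp add: norm_mult e(1) s_def)
qed

text \<open>
  The choice of the odd case is kept for \<open>i < n\<close>; the middle entry is \<open>\<beta> = v n\<close>.  Taking \<open>\<beta> c n\<close> in
  phase with \<open>c (2 * n)\<close> and \<open>|\<beta>| = t\<close>, and estimating the extra term \<open>c 0 * \<beta>\<^sup>2\<close> by
  \<open>a t\<^sup>2\<close>, leaves \<open>|c (2 n)| \<le> 1 - s - 2 t |c n| + (1 + a) t\<^sup>2\<close>.  The right-hand side is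
  smallest at \<open>t = |c n| / (1 + a)\<close>.
\<close>

lemma carlson_even:
  assumes f: "bounded_by_one_expansion f c" and "n > 0"
  shows "norm (c (2 * n)) \<le> 1 - (\<Sum>k<n. (norm (c k))\<^sup>2) - (norm (c n))\<^sup>2 / (1 + norm (c 0))"
proof -
  obtain e where e: "norm e = 1" "cnj e * c (2 * n) = of_real (norm (c (2 * n)))"
    by (rule obtain_phase)
  have e1: "cnj e * e = 1" using e(1) complex_norm_square[of e] by (simp add: mult.commute)
  define a where "a = norm (c 0)"
  define s where "s = (\<Sum>k<n. (norm (c k))\<^sup>2)"
  define b where "b = (norm (c n))\<^sup>2"
  define \<beta> where "\<beta> = e * cnj (c n) / of_real (1 + a)"
  have a: "0 \<le> a" by (simp add: a_def)
  have norm_\<beta>: "(norm \<beta>)\<^sup>2 = b / (1 + a)\<^sup>2"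
    using a by (simp add: \<beta>_def b_def norm_mult norm_divide e(1) power_divide del: of_real_add)
  have c\<beta>: "c n * \<beta> = e * of_real (b / (1 + a))"
    by (simp add: \<beta>_def b_def complex_norm_square mult_ac del: of_real_power of_real_add)
  have main: "norm (c (2 * n) + 2 * e * of_real (s + b / (1 + a)) + c 0 * \<beta>\<^sup>2) \<le> 1 + (s + b / (1 + a)\<^sup>2)"
  proof -
    let ?v = "\<lambda>i. if i < n then e * cnj (c i) else \<beta>"
    have "(\<Sum>i\<le>n. c i * ?v i) = (\<Sum>i<n. c i * (e * cnj (c i))) + c n * \<beta>"
      by (simp add: lessThan_Suc_atMost[symmetric])
    also have "(\<Sum>i<n. c i * (e * cnj (c i))) = e * of_real s"
      by (simp add: s_def complex_norm_square sum_distrib_left mult_ac del: of_real_power)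
    finally have 1: "(\<Sum>i\<le>n. c i * ?v i) = e * of_real (s + b / (1 + a))"
      by (simp only: c\<beta> of_real_add distrib_left)
    have 2: "(\<Sum>i\<le>n. (norm (?v i))\<^sup>2) = s + b / (1 + a)\<^sup>2"
      by (simp add: lessThan_Suc_atMost[symmetric] norm_\<beta> norm_mult e(1) s_def)
    have "norm (c (2 * n) + 2 * (\<Sum>i\<le>n. c i * ?v i) + c 0 * \<beta>\<^sup>2) \<le> 1 + (\<Sum>i\<le>n. (norm (?v i))\<^sup>2)"
      using weighted_coefficient_bound[OF f, of "2 * n" ?v] \<open>n > 0\<close> by simp
    then show ?thesis unfolding 1 2 by (simp only: mult.assoc)
  qed
  have "norm (c (2 * n)) + 2 * (s + b / (1 + a)) - a * (b / (1 + a)\<^sup>2)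
      \<le> norm (cnj e * (c (2 * n) + 2 * e * of_real (s + b / (1 + a)) + c 0 * \<beta>\<^sup>2))"
  proof -
    let ?R = "norm (c (2 * n)) + 2 * (s + b / (1 + a))"
    have "cnj e * (c (2 * n) + 2 * e * of_real (s + b / (1 + a)) + c 0 * \<beta>\<^sup>2)
        = cnj e * c (2 * n) + 2 * (cnj e * e) * of_real (s + b / (1 + a)) + cnj e * (c 0 * \<beta>\<^sup>2)"
      by (simp only: algebra_simps)
    also have "\<dots> = of_real ?R + cnj e * (c 0 * \<beta>\<^sup>2)"
      unfolding e(2) e1 by simp
    finally have eq: "cnj e * (c (2 * n) + 2 * e * of_real (s + b / (1 + a)) + c 0 * \<beta>\<^sup>2)
        = of_real ?R + cnj e * (c 0 * \<beta>\<^sup>2)" .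
    have "norm (cnj e * (c 0 * \<beta>\<^sup>2)) = a * (b / (1 + a)\<^sup>2)"
      by (simp add: norm_mult norm_power e(1) norm_\<beta> a_def)
    moreover have "norm (complex_of_real ?R) - norm (cnj e * (c 0 * \<beta>\<^sup>2))
        \<le> norm (of_real ?R + cnj e * (c 0 * \<beta>\<^sup>2))"
      by (rule norm_diff_ineq)
    moreover have "norm (complex_of_real ?R) = \<bar>?R\<bar>" by (rule norm_of_real)
    ultimately show ?thesis unfolding eq by linarith
  qed
  then have "norm (c (2 * n)) + 2 * (s + b / (1 + a)) - a * (b / (1 + a)\<^sup>2) \<le> 1 + (s + b / (1 + a)\<^sup>2)"
    using main by (simp add: norm_mult e(1))
  moreover have "b / (1 + a)\<^sup>2 + a * (b / (1 + a)\<^sup>2) = b / (1 + a)"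
    using a by (simp add: power2_eq_square divide_simps) (simp add: algebra_simps)
  moreover have "X \<le> 1 - s - t" if "X + 2 * (s + t) - y \<le> 1 + (s + z)" "z + y = t" for X y z t :: real
    using that by argo
  ultimately show ?thesis unfolding s_def[symmetric] a_def[symmetric] b_def[symmetric] by blast
qed

section \<open>The sharp bound for the coefficient series\<close>

text \<open>
  The subtracted term \<open>(1 - s\<^sub>N) r ^ (2 N + 1) / (1 - r)\<close> is the geometric tail that remains
  when \<open>1 - s\<^sub>N\<close> bounds every later coefficient.  With it the induction telescopes: in each step
  two coefficients, one odd and one even, are added, and replacing them by Carlson's bounds turns the
  step into an identity.
\<close>

lemma coefficient_sum_bound:
  fixes c :: "nat \<Rightarrow> complex" and r :: real
  assumes f: "bounded_by_one_expansion f c" and r: "0 \<le> r" "r < 1"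
  defines "a \<equiv> norm (c 0)"
  shows "(\<Sum>n<2*N. norm (c (Suc n)) * r ^ Suc n)
      + (1 / (1 + a) + r / (1 - r)) * (\<Sum>n<N. (norm (c (Suc n)))\<^sup>2 * r ^ (2 * Suc n))
    \<le> ((1 - a\<^sup>2) * r - (1 - (\<Sum>k\<le>N. (norm (c k))\<^sup>2)) * r ^ (2 * N + 1)) / (1 - r)"
proof (induction N)
  case (Suc N)
  define s where "s = (\<Sum>k\<le>N. (norm (c k))\<^sup>2)"
  define b where "b = (norm (c (Suc N)))\<^sup>2"
  define u where "u = r ^ (2 * N + 1)"
  have u: "0 \<le> u" using r by (simp add: u_def)
  have pow: "r ^ Suc (2 * N) = u" "r ^ Suc (Suc (2 * N)) = u * r" "r ^ (2 * Suc N) = u * r"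
    "r ^ Suc (Suc (Suc (2 * N))) = u * r * r" by (simp_all add: u_def)
  have 1: "norm (c (Suc (2 * N))) * u \<le> (1 - s) * u"
    using carlson_odd[OF f, of N] by (intro mult_right_mono u) (simp add: s_def)
  have 2: "norm (c (Suc (Suc (2 * N)))) * (u * r) \<le> (1 - s - b / (1 + a)) * (u * r)"
    using carlson_even[OF f, of "Suc N"] r u
    by (intro mult_right_mono) (simp_all add: s_def b_def a_def lessThan_Suc_atMost)
  have "(1 - s) * u + (1 - s - b / (1 + a)) * (u * r) + (1 / (1 + a) + r / (1 - r)) * (b * (u * r))
      + ((1 - a\<^sup>2) * r - (1 - s) * u) / (1 - r) = ((1 - a\<^sup>2) * r - (1 - (s + b)) * (u * r * r)) / (1 - r)"
  proof -
    have "(b / (1 + a)) * (u * r) = 1 / (1 + a) * (b * (u * r))" by simp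
    then have "(1 - s) * u + (1 - s - b / (1 + a)) * (u * r) + (1 / (1 + a) + r / (1 - r)) * (b * (u * r))
       = (1 - s) * u + (1 - s) * (u * r) + r / (1 - r) * (b * (u * r))"
      by (simp add: algebra_simps)
    then show ?thesis using r by (simp add: divide_simps) (simp add: algebra_simps)
  qed
  with Suc.IH 1 2 show ?case
    by (simp add: pow s_def[symmetric] b_def[symmetric] u_def[symmetric] distrib_left del: power_Suc)
qed (simp add: a_def)


lemma bohr_sum_le:
  assumes f: "bounded_by_one_expansion f c" and r: "0 \<le> r" "r < 1"
  defines "a \<equiv> norm (c 0)"
  shows "(\<Sum>n. norm (c (Suc n)) * r ^ Suc n)
      + (1 / (1 + a) + r / (1 - r)) * (\<Sum>n. (norm (c (Suc n)))\<^sup>2 * r ^ (2 * Suc n))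
    \<le> (1 - a\<^sup>2) * r / (1 - r)"
proof (rule LIMSEQ_le_const2)
  let ?A = "\<lambda>N. \<Sum>n<N. norm (c (Suc n)) * r ^ Suc n"
  let ?B = "\<lambda>N. \<Sum>n<N. (norm (c (Suc n)))\<^sup>2 * r ^ (2 * Suc n)"
  let ?K = "1 / (1 + a) + r / (1 - r)"
  have "norm (complex_of_real r) < 1" using r by simp
  note summable = bohr_series_summable[OF f this, unfolded norm_of_real abs_of_nonneg[OF r(1)]]
  have "?A \<longlonglongrightarrow> (\<Sum>n. norm (c (Suc n)) * r ^ Suc n)"
    using summable(1) by (rule summable_LIMSEQ)
  then have "(\<lambda>N. ?A (2 * N)) \<longlonglongrightarrow> (\<Sum>n. norm (c (Suc n)) * r ^ Suc n)"
    by (rule filterlim_compose) (intro filterlim_subseq strict_monoI, simp)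
  then show "(\<lambda>N. ?A (2 * N) + ?K * ?B N) \<longlonglongrightarrow>
      (\<Sum>n. norm (c (Suc n)) * r ^ Suc n) + ?K * (\<Sum>n. (norm (c (Suc n)))\<^sup>2 * r ^ (2 * Suc n))"
    by (intro tendsto_intros summable_LIMSEQ summable)
  show "\<exists>M. \<forall>N\<ge>M. ?A (2 * N) + ?K * ?B N \<le> (1 - a\<^sup>2) * r / (1 - r)"
  proof (intro exI allI impI)
    fix N :: nat
    have "(\<Sum>k\<le>N. (norm (c k))\<^sup>2) \<le> 1"
      using carlson_odd[OF f, of N] norm_ge_zero[of "c (2 * N + 1)"] by linarith
    then have "0 \<le> (1 - (\<Sum>k\<le>N. (norm (c k))\<^sup>2)) * r ^ (2 * N + 1)"
      using r by (intro mult_nonneg_nonneg) auto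
    then have "((1 - a\<^sup>2) * r - (1 - (\<Sum>k\<le>N. (norm (c k))\<^sup>2)) * r ^ (2 * N + 1)) / (1 - r)
        \<le> (1 - a\<^sup>2) * r / (1 - r)"
      using r by (intro divide_right_mono) auto
    with coefficient_sum_bound[OF f r, of N]
    show "?A (2 * N) + ?K * ?B N \<le> (1 - a\<^sup>2) * r / (1 - r)"
      unfolding a_def by linarith
  qed
qed

section \<open>The Schwarz--Pick estimate\<close>

lemma moebius_norm_identity:
  fixes \<alpha> w :: complex
  shows "(norm (1 - cnj \<alpha> * w))\<^sup>2 - (norm (w - \<alpha>))\<^sup>2 = (1 - (norm \<alpha>)\<^sup>2) * (1 - (norm w)\<^sup>2)"
  unfolding cmod_power2 by (simp add: power2_eq_square algebra_simps)

lemma moebius_norm_le: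
  assumes "norm \<alpha> \<le> 1" "norm w \<le> 1"
  shows "norm (w - \<alpha>) \<le> norm (1 - cnj \<alpha> * w)"
proof -
  have "0 \<le> (1 - (norm \<alpha>)\<^sup>2) * (1 - (norm w)\<^sup>2)"
    using assms by (intro mult_nonneg_nonneg) (auto simp: power_le_one)
  then have "(norm (w - \<alpha>))\<^sup>2 \<le> (norm (1 - cnj \<alpha> * w))\<^sup>2"
    using moebius_norm_identity[of \<alpha> w] by linarith
  then show ?thesis by (rule power2_le_imp_le) simp
qed

lemma moebius_denominator_nonzero:
  fixes \<alpha> w :: complex
  assumes "norm \<alpha> < 1" "norm w \<le> 1"
  shows "1 - cnj \<alpha> * w \<noteq> 0"
proof
  assume "1 - cnj \<alpha> * w = 0"
  then have "norm (cnj \<alpha> * w) = 1" by simp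
  moreover have "norm \<alpha> * norm w \<le> norm \<alpha>" using assms by (simp add: mult_left_le)
  ultimately show False using assms by (simp add: norm_mult)
qed

text \<open>
  The Schwarz lemma, applied to \<open>g = (f - \<alpha>) / (1 - cnj \<alpha> * f)\<close> with \<open>\<alpha> = f 0\<close>, gives
  \<open>|f z - \<alpha>| \<le> |z| |1 - cnj \<alpha> f z|\<close>.  The identity for Moebius maps lets this be compared with
  the real case, in which \<open>\<alpha>\<close> and \<open>f z\<close> are replaced by their moduli \<open>a\<close> and \<open>\<omega>\<close>.
\<close>

lemma schwarz_pick_at_zero:
  assumes f: "bounded_by_one_expansion f c" and a: "norm (c 0) < 1" and z: "norm z < 1"
  shows "norm (f z) \<le> (norm z + norm (c 0)) / (1 + norm (c 0) * norm z)"
proof -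
  define \<alpha> where "\<alpha> = c 0"
  define g where "g = (\<lambda>z. (f z - \<alpha>) / (1 - cnj \<alpha> * f z))"
  define r where "r = norm z"
  define a where "a = norm \<alpha>"
  define \<omega> where "\<omega> = norm (f z)"
  have \<alpha>: "norm \<alpha> < 1" and a01: "0 \<le> a" "a < 1" and r: "0 \<le> r" "r < 1" using assms by (auto simp: \<alpha>_def r_def a_def)
  have holf: "f holomorphic_on ball 0 1" and le1: "\<And>z. norm z < 1 \<Longrightarrow> norm (f z) \<le> 1"
    using f by (auto simp: bounded_by_one_expansion_def analytic_imp_holomorphic)
  have f0: "f 0 = \<alpha>"
  proof -
    have "(\<lambda>n. c n * 0 ^ n) sums f 0"
      using f unfolding bounded_by_one_expansion_def by (metis centre_in_ball zero_less_one)
    then show ?thesis by (simp add: \<alpha>_def)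
  qed
  have nz: "1 - cnj \<alpha> * f z \<noteq> 0" if "norm z < 1" for z
    using \<alpha> le1[OF that] by (rule moebius_denominator_nonzero)
  have g_le1: "norm (g z) \<le> 1" if "norm z < 1" for z
    using moebius_norm_le[of \<alpha> "f z"] \<alpha> le1[OF that] nz[OF that]
    by (simp add: g_def norm_divide divide_le_eq)
  have holg: "g holomorphic_on ball 0 1"
    unfolding g_def using nz by (intro holomorphic_intros holf) auto
  \<comment> \<open>The factor \<open>t\<close> makes the modulus strictly less than 1, as the Schwarz lemma demands.\<close>
  have "t * norm (g z) \<le> norm z" if t: "0 < t" "t < 1" for t
  proof -
    have "norm (of_real t * g z) \<le> norm z"
    proof (rule Schwarz_Lemma(1)[where f = "\<lambda>z. of_real t * g z"])
      show "(\<lambda>z. of_real t * g z) holomorphic_on ball 0 1"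
        by (intro holomorphic_intros holg)
      show "norm (of_real t * g w) < 1" if "norm w < 1" for w
      proof -
        have "norm (of_real t * g w) = t * norm (g w)" using t by (simp add: norm_mult)
        also have "\<dots> \<le> t" using g_le1[OF that] t by (simp add: mult_left_le)
        finally show ?thesis using t by simp
      qed
    qed (use z f0 in \<open>auto simp: g_def\<close>)
    then show ?thesis using t by (simp add: norm_mult)
  qed
  then have "norm (g z) \<le> r"
    unfolding r_def by (rule field_le_mult_one_interval)
  then have "norm (f z - \<alpha>) \<le> r * norm (1 - cnj \<alpha> * f z)"
    using nz[OF z] by (simp add: g_def norm_divide divide_le_eq)
  then have "(norm (f z - \<alpha>))\<^sup>2 \<le> r\<^sup>2 * (norm (1 - cnj \<alpha> * f z))\<^sup>2"
    by (metis norm_ge_zero power_mono power_mult_distrib)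
  then have 1: "(1 - r\<^sup>2) * (norm (1 - cnj \<alpha> * f z))\<^sup>2 \<le> (1 - a\<^sup>2) * (1 - \<omega>\<^sup>2)"
    using moebius_norm_identity[of \<alpha> "f z"] by (simp add: a_def \<omega>_def algebra_simps)
  have \<omega>: "0 \<le> \<omega>" "\<omega> \<le> 1" using le1[OF z] by (auto simp: \<omega>_def)
  have a\<omega>: "a * \<omega> \<le> 1" using a01 \<omega> by (simp add: mult_le_one)
  have "1 - a * \<omega> \<le> norm (1 - cnj \<alpha> * f z)"
    using norm_triangle_ineq2[of 1 "cnj \<alpha> * f z"] by (simp add: norm_mult a_def \<omega>_def)
  then have "(1 - a * \<omega>)\<^sup>2 \<le> (norm (1 - cnj \<alpha> * f z))\<^sup>2"
    using a\<omega> by (intro power_mono) auto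
  then have "(1 - r\<^sup>2) * (1 - a * \<omega>)\<^sup>2 \<le> (1 - r\<^sup>2) * (norm (1 - cnj \<alpha> * f z))\<^sup>2"
    using r by (intro mult_left_mono) (auto simp: power_le_one)
  also note 1
  also have "(1 - a\<^sup>2) * (1 - \<omega>\<^sup>2) = (1 - a * \<omega>)\<^sup>2 - (\<omega> - a)\<^sup>2"
    by (simp add: power2_eq_square algebra_simps)
  finally have "(\<omega> - a)\<^sup>2 \<le> (r * (1 - a * \<omega>))\<^sup>2"
    by (simp add: power_mult_distrib left_diff_distrib)
  then have "\<omega> - a \<le> r * (1 - a * \<omega>)"
    by (rule power2_le_imp_le) (use r a\<omega> in simp)
  then have "\<omega> * (1 + a * r) \<le> r + a" by (simp add: algebra_simps)
  moreover have "0 < 1 + a * r" using a01 r by (simp add: add_pos_nonneg)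
  ultimately have "\<omega> \<le> (r + a) / (1 + a * r)" by (simp add: le_divide_eq)
  then show ?thesis by (simp add: \<omega>_def a_def r_def \<alpha>_def)
qed

section \<open>The radius\<close>

text \<open>
  The amount by which Schwarz--Pick and the bound for the coefficient series together stay below 1.
\<close>

definition bohr_gap :: "real \<Rightarrow> real \<Rightarrow> real \<Rightarrow> real" where
  "bohr_gap a p r = 1 - (1 - a\<^sup>2) * r / (1 - r) - ((r + a) / (1 + a * r)) powr p"

lemma A_fun_eq_bohr_gap:
  assumes "0 \<le> a" "0 \<le> r" "r < 1"
  shows "A_fun a p r = (1 - r) * (1 + a * r) powr p * bohr_gap a p r"
proof -
  have d: "0 < 1 + a * r" using assms by (simp add: add_pos_nonneg)
  have "(1 - r) * (1 - (1 - a\<^sup>2) * r / (1 - r)) = 1 - (2 - a\<^sup>2) * r"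
    using assms by (simp add: field_simps)
  then have "(1 - (2 - a\<^sup>2) * r) * (1 + a * r) powr p
      = (1 - r) * (1 + a * r) powr p * (1 - (1 - a\<^sup>2) * r / (1 - r))"
    by (metis mult.assoc mult.commute)
  moreover have "(1 + a * r) powr p * ((r + a) / (1 + a * r)) powr p = (r + a) powr p"
    using d assms by (simp add: powr_divide)
  ultimately show ?thesis
    by (simp add: A_fun_def bohr_gap_def algebra_simps)
qed

text \<open>
  Both \<open>r / (1 - r)\<close> and \<open>(r + a) / (1 + a * r)\<close> increase with \<open>r\<close>, the latter strictly
  because \<open>a < 1\<close>.
\<close>

lemma bohr_gap_strict_decreasing:
  assumes p: "p > 0" and a: "0 \<le> a" "a < 1" and r: "0 \<le> r" "r < s" "s < 1"
  shows "bohr_gap a p s < bohr_gap a p r"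
proof -
  have d: "0 < 1 + a * r" "0 < 1 + a * s" using a r by (auto simp: add_pos_nonneg)
  have a2: "a * a < 1" using a mult_strict_mono'[of a 1 a 1] by simp
  have "(1 - a * a) * r < (1 - a * a) * s" using a2 r by simp
  then have "(r + a) / (1 + a * r) < (s + a) / (1 + a * s)"
    using d by (simp add: frac_less_eq algebra_simps divide_less_eq less_divide_eq)
  then have "((r + a) / (1 + a * r)) powr p < ((s + a) / (1 + a * s)) powr p"
    using p a r by (intro powr_less_mono2) auto
  moreover have "(1 - a\<^sup>2) * r / (1 - r) \<le> (1 - a\<^sup>2) * s / (1 - s)"
    using a r a2 by (intro frac_le mult_left_mono) (auto simp: power2_eq_square)
  ultimately show ?thesis by (simp add: bohr_gap_def)
qed

lemma bohr_gap_r_min: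
  assumes p: "p > 0" and a: "0 \<le> a" "a < 1"
  shows "bohr_gap a p (r_min a p) = 0"
proof -
  have "0 < 1 + a * r_min a p" using r_min_is_least(1)[OF assms] a by (simp add: add_pos_nonneg)
  then show ?thesis
    using r_min_is_least(1-3)[OF assms] A_fun_eq_bohr_gap[of a "r_min a p" p] a by auto
qed

section \<open>The extremal function\<close>

lemma disc_automorphism_expansion:
  fixes a :: real
  assumes a: "0 \<le> a" "a < 1"
  defines "f \<equiv> \<lambda>z :: complex. (of_real a - z) / (1 - of_real a * z)"
    and "c \<equiv> \<lambda>n. case n of 0 \<Rightarrow> of_real a | Suc n \<Rightarrow> - of_real ((1 - a\<^sup>2) * a ^ n)"
  shows "bounded_by_one_expansion f c"
  unfolding bounded_by_one_expansion_def
proof (intro conjI ballI)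
  have nz: "1 - of_real a * z \<noteq> 0" if "z \<in> ball 0 1" for z :: complex
    using moebius_denominator_nonzero[of "of_real a" z] a that by auto
  then show "f analytic_on ball 0 1"
    unfolding f_def by (intro analytic_intros) auto
  fix z :: complex assume z: "z \<in> ball 0 1"
  have "norm (of_real a * z) < 1"
    using mult_strict_mono'[of a 1 "norm z" 1] z a by (simp add: norm_mult)
  then have "(\<lambda>n. (of_real a * z) ^ n) sums (1 / (1 - of_real a * z))"
    by (rule geometric_sums)
  then have "(\<lambda>n. - of_real (1 - a\<^sup>2) * z * (of_real a * z) ^ n) sums
      (- of_real (1 - a\<^sup>2) * z * (1 / (1 - of_real a * z)))"
    by (rule sums_mult)
  moreover have "- of_real (1 - a\<^sup>2) * z * (of_real a * z) ^ n = c (Suc n) * z ^ Suc n" for n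
    by (simp add: c_def power_mult_distrib algebra_simps)
  ultimately have "(\<lambda>n. c (Suc n) * z ^ Suc n) sums (- of_real (1 - a\<^sup>2) * z * (1 / (1 - of_real a * z)))"
    by (simp only:)
  then have "(\<lambda>n. c n * z ^ n) sums (- of_real (1 - a\<^sup>2) * z * (1 / (1 - of_real a * z)) + c 0 * z ^ 0)"
    by (rule sums_Suc)
  also have "- of_real (1 - a\<^sup>2) * z * (1 / (1 - of_real a * z)) + c 0 * z ^ 0 = f z"
    using nz[OF z] by (simp add: c_def f_def field_simps power2_eq_square)
  finally show "(\<lambda>n. c n * z ^ n) sums f z" .
  show "norm (f z) \<le> 1"
    using moebius_norm_le[of "of_real a" z] a z nz[OF z]
    by (simp add: f_def norm_divide divide_le_eq norm_minus_commute)
qed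

text \<open>
  Equality in both estimates at once: at \<open>- r\<close> the automorphism attains the Schwarz--Pick bound, and
  since its coefficients form a geometric progression the two series have closed forms, which add up
  to \<open>(1 - a\<^sup>2) r / (1 - r)\<close>.
\<close>

lemma bohr_lhs_disc_automorphism:
  fixes a r :: real
  assumes a: "0 \<le> a" "a < 1" and r: "0 \<le> r" "r < 1"
  defines "f \<equiv> \<lambda>z :: complex. (of_real a - z) / (1 - of_real a * z)"
    and "c \<equiv> \<lambda>n. case n of 0 \<Rightarrow> of_real a | Suc n \<Rightarrow> - of_real ((1 - a\<^sup>2) * a ^ n)"
  shows "bohr_lhs p f c (- of_real r) = 1 - bohr_gap a p r"
proof -
  have ar: "0 \<le> a * r" "a * r < 1"
    using mult_strict_mono'[of a 1 r 1] a r by auto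
  have a2: "0 \<le> 1 - a\<^sup>2" using a by (simp add: power_le_one)
  have c0: "norm (c 0) = a" and cS: "norm (c (Suc n)) = (1 - a\<^sup>2) * a ^ n" for n
    using a a2 by (auto simp: c_def norm_mult norm_power simp del: of_real_mult of_real_power of_real_diff)
  have "f (- of_real r) = of_real ((r + a) / (1 + a * r))"
    by (simp add: f_def add.commute)
  then have fr: "norm (f (- of_real r)) = (r + a) / (1 + a * r)"
    using a r by (simp del: of_real_divide of_real_add of_real_mult)
  have "(\<lambda>n. (a * r) ^ n) sums (1 / (1 - a * r))"
    using ar by (intro geometric_sums) simp
  then have "(\<lambda>n. (1 - a\<^sup>2) * r * (a * r) ^ n) sums ((1 - a\<^sup>2) * r * (1 / (1 - a * r)))"
    by (rule sums_mult)
  then have S1: "(\<Sum>n. norm (c (Suc n)) * r ^ Suc n) = (1 - a\<^sup>2) * r * (1 / (1 - a * r))"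
    by (simp add: cS sums_iff power_mult_distrib mult_ac)
  have "(\<lambda>n. ((a * r)\<^sup>2) ^ n) sums (1 / (1 - (a * r)\<^sup>2))"
    using ar by (intro geometric_sums) (simp add: power_less_one_iff abs_square_less_1)
  then have "(\<lambda>n. (1 - a\<^sup>2)\<^sup>2 * r\<^sup>2 * ((a * r)\<^sup>2) ^ n) sums ((1 - a\<^sup>2)\<^sup>2 * r\<^sup>2 * (1 / (1 - (a * r)\<^sup>2)))"
    by (rule sums_mult)
  moreover have "(1 - a\<^sup>2)\<^sup>2 * r\<^sup>2 * ((a * r)\<^sup>2) ^ n = (norm (c (Suc n)))\<^sup>2 * r ^ (2 * Suc n)" for n
    unfolding cS power_mult by (simp add: power2_eq_square power_mult_distrib mult_ac)
  ultimately have S2: "(\<Sum>n. (norm (c (Suc n)))\<^sup>2 * r ^ (2 * Suc n)) = (1 - a\<^sup>2)\<^sup>2 * r\<^sup>2 * (1 / (1 - (a * r)\<^sup>2))"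
    by (simp add: sums_iff)
  have cancel: "P / (Q * R) * (X * (Y * Q) * Z / (W * P)) = X * Y * Z / (R * W)"
    if "0 < P" "0 < Q" for P Q R X Y Z W :: real
    using that by simp
  have "1 / (1 + a) + r / (1 - r) = (1 + a * r) / ((1 + a) * (1 - r))"
    using a r by (simp add: divide_simps) (simp add: algebra_simps)
  moreover have "(1 - a\<^sup>2)\<^sup>2 * r\<^sup>2 * (1 / (1 - (a * r)\<^sup>2))
     = (1 - a\<^sup>2) * ((1 - a) * (1 + a)) * r\<^sup>2 / ((1 - a * r) * (1 + a * r))"
  proof -
    have "1 - a\<^sup>2 = (1 - a) * (1 + a)" "1 - (a * r)\<^sup>2 = (1 - a * r) * (1 + a * r)"
      by (simp_all add: power2_eq_square algebra_simps)
    then show ?thesis by (simp add: power2_eq_square)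
  qed
  ultimately have "(1 / (1 + a) + r / (1 - r)) * ((1 - a\<^sup>2)\<^sup>2 * r\<^sup>2 * (1 / (1 - (a * r)\<^sup>2)))
     = (1 - a\<^sup>2) * (1 - a) * r\<^sup>2 / ((1 - r) * (1 - a * r))"
    using cancel[of "1 + a * r" "1 + a" "1 - r" "1 - a\<^sup>2" "1 - a" "r\<^sup>2" "1 - a * r"] a ar
    by auto
  moreover have "(1 - a\<^sup>2) * r * (1 / (1 - a * r)) + (1 - a\<^sup>2) * (1 - a) * r\<^sup>2 / ((1 - r) * (1 - a * r))
     = (1 - a\<^sup>2) * r / (1 - r)"
    using r ar by (simp add: divide_simps) (simp add: power2_eq_square algebra_simps)
  ultimately show ?thesis
    unfolding bohr_lhs_def Let_def norm_minus_cancel norm_of_real abs_of_nonneg[OF r(1)]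
      c0 S1 S2 fr bohr_gap_def
    by (simp only: add.assoc)
qed

section \<open>The Bohr-type inequality and the optimality of the radius\<close>

theorem lemma3:
  fixes p :: real
  assumes "p > 0"
  shows
    "(\<forall>f c z. bounded_by_one_expansion f c \<and> norm (c 0) < 1 \<and> norm z \<le> r_min (norm (c 0)) p
        \<longrightarrow> bohr_lhs p f c z \<le> 1) \<and>
     (\<forall>a \<rho>. 0 \<le> a \<and> a < 1 \<and> r_min a p < \<rho> \<and> \<rho> < 1
        \<longrightarrow> (\<exists>f c z. bounded_by_one_expansion f c \<and> norm (f 0) = a \<and> norm z \<le> \<rho> \<and>
                     \<not> bohr_lhs p f c z \<le> 1))"
proof (intro conjI allI impI; elim conjE)
  fix f c and z :: complex
  assume f: "bounded_by_one_expansion f c" and c0: "norm (c 0) < 1"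
    and z: "norm z \<le> r_min (norm (c 0)) p"
  define a where "a = norm (c 0)"
  have a: "0 \<le> a" "a < 1" using c0 by (auto simp: a_def)
  have z1: "norm z < 1" using z r_min_is_least(2)[OF assms a] by (simp add: a_def)
  have "norm (f z) powr p \<le> ((norm z + a) / (1 + a * norm z)) powr p"
    using schwarz_pick_at_zero[OF f c0 z1] assms by (intro powr_mono2) (auto simp: a_def)
  moreover have "0 \<le> bohr_gap a p (norm z)"
  proof (cases "norm z = r_min a p")
    case False
    then show ?thesis
      using bohr_gap_strict_decreasing[OF assms a, of "norm z" "r_min a p"] z
        bohr_gap_r_min[OF assms a] r_min_is_least(2)[OF assms a] by (simp add: a_def)
  qed (simp add: bohr_gap_r_min[OF assms a])
  ultimately show "bohr_lhs p f c z \<le> 1"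
    using bohr_sum_le[OF f norm_ge_zero z1]
    by (simp add: bohr_lhs_def Let_def bohr_gap_def a_def)
next
  fix a \<rho> :: real
  assume a: "0 \<le> a" "a < 1" and \<rho>: "r_min a p < \<rho>" "\<rho> < 1"
  define f where "f = (\<lambda>z :: complex. (of_real a - z) / (1 - of_real a * z))"
  define c where "c = (\<lambda>n. case n of 0 \<Rightarrow> complex_of_real a | Suc n \<Rightarrow> - of_real ((1 - a\<^sup>2) * a ^ n))"
  have r0: "0 < r_min a p" using r_min_is_least(1)[OF assms a] .
  have "bohr_gap a p \<rho> < 0"
    using bohr_gap_strict_decreasing[OF assms a, of "r_min a p" \<rho>] \<rho> r0 bohr_gap_r_min[OF assms a] by simp
  then have "\<not> bohr_lhs p f c (- of_real \<rho>) \<le> 1"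
    unfolding f_def c_def using bohr_lhs_disc_automorphism[OF a, of \<rho> p] r0 \<rho> by simp
  moreover have "bounded_by_one_expansion f c"
    unfolding f_def c_def by (rule disc_automorphism_expansion[OF a])
  moreover have "norm (f 0) = a" "norm (- complex_of_real \<rho>) \<le> \<rho>"
    using a r0 \<rho> by (auto simp: f_def)
  ultimately show "\<exists>f c z. bounded_by_one_expansion f c \<and> norm (f 0) = a \<and> norm z \<le> \<rho> \<and>
                     \<not> bohr_lhs p f c z \<le> 1"
    by blast
qed

end
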